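(* Let $q_1,q_2$ be the two models returned by the Sharded-Safe procedure and let $p$ be the model returned by the CP-$\Delta$ algorithm for $\Delta\in\{\Delta_{\max},\Delta_{\mathrm{KL}}\}$, i.e. $p(y|x)=\min\{q_1(y|x),q_2(y|x)\}/Z(x)$ if $\Delta=\Delta_{\max}$ and $p(y|x)=\sqrt{q_1(y|x)q_2(y|x)}/Z(x)$ if $\Delta=\Delta_{\mathrm{KL}}$, where $Z(x)$ is the normalizing constant, assumed positive. Then, for every prompt $x$: for $i\in\{1,2\}$ and $\Delta=\Delta_{\max}$, \[ \mathsf{TV}\bigl(p(\cdot|x),q_i(\cdot|x)\bigr)\le\mathsf{TV}\bigl(q_1(\cdot|x),q_2(\cdot|x)\bigr), \] and for $i\in\{1,2\}$ and $\Delta=\Delta_{\mathrm{KL}}$, \[ \mathsf{KL}\bigl(p(\cdot|x)\,\|\,q_i(\cdot|x)\bigr)\le-2\log\bigl(1-\mathsf H^2(q_1(\cdot|x),q_2(\cdot|x))\bigr). \]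
   Context: $\mathcal X$ is a set of prompts and $\mathcal Y$ a discrete (countable) set of outputs. A conditional generative model assigns to each $x\in\mathcal X$ a probability mass function on $\mathcal Y$. All logarithms are base 2. For distributions $\rho,\mu$ on $\mathcal Y$: $\mathsf{TV}(\rho,\mu)=\frac12\sum_y|\rho(y)-\mu(y)|$; $\mathsf H^2(\rho,\mu)=1-\sum_y\sqrt{\rho(y)\mu(y)}$; $\mathsf{KL}(\rho\|\mu)=\Delta_{\mathrm{KL}}(\rho\|\mu)=\mathbb E_{y\sim\rho}\log\frac{\rho(y)}{\mu(y)}$; $\Delta_{\max}(\rho\|\mu)=\max_{y\in\mathrm{Supp}(\rho)}\log\frac{\rho(y)}{\mu(y)}$. Sharded-Safe procedure: given a learning algorithm $\mathcal A$ mapping datasets to conditional generative models and a dataset $\mathcal D$, partition $\mathcal D$ into two datasets $\mathcal D_1,\mathcal D_2$ and set $q_1=\mathcal A(\mathcal D_1)$, $q_2=\mathcal A(\mathcal D_2)$ (so $q_1,q_2$ may be arbitrary conditional generative models). CP-$\Delta$ runs this procedure and returns the model $p$ given by the formula in the claim. *)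

theory Defs
  imports "HOL-Probability.Probability"
begin

type_synonym ('x, 'y) cond_model = "'x \<Rightarrow> 'y pmf"

type_synonym ('z, 'x, 'y) learner = "'z multiset \<Rightarrow> ('x, 'y) cond_model"

text \<open>
  The pairs of models that can result from sharding \<open>D\<close>. A dataset is a multiset of data points,
  and a partition splits it into two sub-multisets; which split is taken is left open.
\<close>
definition sharded_safe ::
    "('z, 'x, 'y) learner \<Rightarrow> 'z multiset \<Rightarrow> ('x, 'y) cond_model \<Rightarrow> ('x, 'y) cond_model \<Rightarrow> bool" where
  "sharded_safe A D q1 q2 \<longleftrightarrow> (\<exists>D1 D2. D = D1 + D2 \<and> q1 = A D1 \<and> q2 = A D2)"

definition tv :: "'y pmf \<Rightarrow> 'y pmf \<Rightarrow> real" where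
  "tv \<rho> \<mu> = 1/2 * (\<Sum>\<^sub>\<infinity>y. \<bar>pmf \<rho> y - pmf \<mu> y\<bar>)"

definition hellinger_sq :: "'y pmf \<Rightarrow> 'y pmf \<Rightarrow> real" where
  "hellinger_sq \<rho> \<mu> = 1 - (\<Sum>\<^sub>\<infinity>y. sqrt (pmf \<rho> y * pmf \<mu> y))"

text \<open>
  The divergence takes values in \<open>[0, \<infinity>]\<close>. It is infinite if \<open>\<rho>\<close> charges a point of \<open>\<mu>\<close>-mass
  \<open>0\<close> (where HOL would give \<open>log 2 (r / 0) = 0\<close>). Otherwise the negative part of the log-ratio
  is \<open>\<rho>\<close>-integrable, so failure of integrability means that the expectation is \<open>+\<infinity>\<close>
  (where the Bochner integral would be \<open>0\<close>).
\<close>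
definition kl :: "'y pmf \<Rightarrow> 'y pmf \<Rightarrow> ereal" where
  "kl \<rho> \<mu> =
     (if set_pmf \<rho> \<subseteq> set_pmf \<mu> \<and>
         integrable (measure_pmf \<rho>) (\<lambda>y. log 2 (pmf \<rho> y / pmf \<mu> y))
      then ereal (measure_pmf.expectation \<rho> (\<lambda>y. log 2 (pmf \<rho> y / pmf \<mu> y)))
      else \<infinity>)"

datatype divergence = Delta_max | Delta_KL

fun cp_weight :: "divergence \<Rightarrow> real \<Rightarrow> real \<Rightarrow> real" where
  "cp_weight Delta_max a b = min a b"
| "cp_weight Delta_KL a b = sqrt (a * b)"

definition cp_Z ::
    "divergence \<Rightarrow> ('x, 'y) cond_model \<Rightarrow> ('x, 'y) cond_model \<Rightarrow> 'x \<Rightarrow> real" where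
  "cp_Z \<Delta> q1 q2 x = (\<Sum>\<^sub>\<infinity>y. cp_weight \<Delta> (pmf (q1 x) y) (pmf (q2 x) y))"

text \<open>Meaningful at prompts with positive normalizing constant; see \<open>pmf_cp_model\<close> below.\<close>
definition cp_model ::
    "divergence \<Rightarrow> ('x, 'y) cond_model \<Rightarrow> ('x, 'y) cond_model \<Rightarrow> ('x, 'y) cond_model" where
  "cp_model \<Delta> q1 q2 x =
     embed_pmf (\<lambda>y. cp_weight \<Delta> (pmf (q1 x) y) (pmf (q2 x) y) / cp_Z \<Delta> q1 q2 x)"

lemma pmf_cp_model:
  assumes "0 < cp_Z \<Delta> q1 q2 x"
  shows "pmf (cp_model \<Delta> q1 q2 x) y =
           cp_weight \<Delta> (pmf (q1 x) y) (pmf (q2 x) y) / cp_Z \<Delta> q1 q2 x"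
proof -
  let ?w = "\<lambda>y. cp_weight \<Delta> (pmf (q1 x) y) (pmf (q2 x) y)"
  let ?Z = "cp_Z \<Delta> q1 q2 x"
  have nn: "0 \<le> ?w y" for y
    by (cases \<Delta>) auto
  have "?w summable_on UNIV"
    using assms infsum_not_exists[of ?w UNIV] unfolding cp_Z_def by linarith
  then have "Infinite_Sum.abs_summable_on ?w UNIV"
    using nn by simp
  then have s: "Infinite_Set_Sum.abs_summable_on ?w UNIV"
    using abs_summable_equivalent by blast
  have "(\<integral>\<^sup>+ y. ennreal (?w y) \<partial>count_space UNIV) = ennreal (infsetsum ?w UNIV)"
    by (rule nn_integral_conv_infsetsum[OF s nn])
  then have e: "(\<integral>\<^sup>+ y. ennreal (?w y) \<partial>count_space UNIV) = ennreal ?Z"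
    unfolding cp_Z_def infsetsum_infsum[OF s] .
  have "(\<integral>\<^sup>+ y. ennreal (?w y / ?Z) \<partial>count_space UNIV)
      = (\<integral>\<^sup>+ y. ennreal (1 / ?Z) * ennreal (?w y) \<partial>count_space UNIV)"
    using assms nn by (intro nn_integral_cong) (simp add: ennreal_mult[symmetric])
  also have "\<dots> = ennreal (1 / ?Z) * ennreal ?Z"
    by (simp add: nn_integral_cmult e)
  also have "\<dots> = 1"
    using assms by (simp add: ennreal_mult[symmetric])
  finally show ?thesis
    unfolding cp_model_def using assms nn by (subst pmf_embed_pmf) auto
qed

end

theory Submission
  imports Defs
begin

lemma pmf_summable_on: "pmf p summable_on A"
proof -
  \<comment> \<open>Summability passes from the notion behind \<open>infsetsum\<close> to the one
    behind \<open>infsum\<close>.\<close>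
  have "Infinite_Sum.abs_summable_on (pmf p) A"
    using pmf_abs_summable abs_summable_equivalent by blast
  then show ?thesis
    by simp
qed

lemma infsum_pmf_UNIV: "infsum (pmf p) UNIV = 1"
  using infsetsum_infsum[OF pmf_abs_summable, of p UNIV] infsetsum_pmf_eq_1[of p UNIV]
  by simp

lemma min_pmf_summable_on: "(\<lambda>y. min (pmf p y) (pmf q y)) summable_on A"
  by (rule summable_on_comparison_test[OF pmf_summable_on[of p A]]) auto

text \<open>Pointwise \<open>\<bar>a - b\<bar> = a + b - 2 * min a b\<close>, and both mass
  functions sum to 1. Total variation is thus one minus the overlap.\<close>

lemma tv_eq_infsum_min: "tv p q = 1 - (\<Sum>\<^sub>\<infinity>y. min (pmf p y) (pmf q y))"
proof -
  let ?m = "\<lambda>y. min (pmf p y) (pmf q y)"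
  have "(\<Sum>\<^sub>\<infinity>y. \<bar>pmf p y - pmf q y\<bar>) = (\<Sum>\<^sub>\<infinity>y. (pmf p y + pmf q y) + (-2) * ?m y)"
    by (rule infsum_cong) auto
  also have "\<dots> = (\<Sum>\<^sub>\<infinity>y. pmf p y + pmf q y) + (\<Sum>\<^sub>\<infinity>y. (-2) * ?m y)"
    by (intro infsum_add summable_on_add summable_on_cmult_right
        pmf_summable_on min_pmf_summable_on)
  also have "\<dots> = 2 - 2 * infsum ?m UNIV"
    by (subst infsum_add[OF pmf_summable_on pmf_summable_on], subst infsum_cmult_right)
      (simp_all add: infsum_pmf_UNIV min_pmf_summable_on)
  finally show ?thesis
    unfolding tv_def by simp
qed

lemma tv_commute: "tv p q = tv q p"
  by (simp add: tv_def abs_minus_commute)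

lemma cp_Z_commute: "cp_Z \<Delta> q1 q2 = cp_Z \<Delta> q2 q1"
  by (cases \<Delta>) (auto simp: cp_Z_def fun_eq_iff min.commute mult.commute)

text \<open>Together with the symmetry of \<open>cp_Z\<close> and of the distances, this reduces the
  bounds for \<open>q2\<close> to those for \<open>q1\<close>.\<close>

lemma cp_model_commute: "cp_model \<Delta> q1 q2 = cp_model \<Delta> q2 q1"
  by (cases \<Delta>) (auto simp: cp_model_def cp_Z_commute[of _ q1] fun_eq_iff min.commute mult.commute)

lemma cp_Z_max: "cp_Z Delta_max q1 q2 x = 1 - tv (q1 x) (q2 x)"
  by (simp add: cp_Z_def tv_eq_infsum_min)

text \<open>Here the normalizer is the Bhattacharyya coefficient of the two models.\<close>

lemma cp_Z_KL: "cp_Z Delta_KL q1 q2 x = 1 - hellinger_sq (q1 x) (q2 x)"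
  by (simp add: cp_Z_def hellinger_sq_def)

text \<open>
  Since \<open>Z \<le> 1\<close>, dividing by \<open>Z\<close> only increases the weight, so the overlap of \<open>p\<close> with \<open>q1\<close>
  is at least that of \<open>q1\<close> with \<open>q2\<close>.
\<close>
lemma tv_cp_model_le:
  assumes Z: "0 < cp_Z Delta_max q1 q2 x"
  shows "tv (cp_model Delta_max q1 q2 x) (q1 x) \<le> tv (q1 x) (q2 x)"
proof -
  let ?p = "cp_model Delta_max q1 q2 x" and ?Z = "cp_Z Delta_max q1 q2 x"
  have "0 \<le> tv (q1 x) (q2 x)"
    by (simp add: tv_def infsum_nonneg)
  then have Z1: "?Z \<le> 1"
    by (simp add: cp_Z_max)
  have "min (pmf (q1 x) y) (pmf (q2 x) y) \<le> min (pmf ?p y) (pmf (q1 x) y)" for y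
  proof -
    have "min (pmf (q1 x) y) (pmf (q2 x) y) * ?Z \<le> min (pmf (q1 x) y) (pmf (q2 x) y)"
      using Z1 by (intro mult_left_le) auto
    then show ?thesis
      using Z by (simp add: pmf_cp_model le_divide_eq)
  qed
  then have "(\<Sum>\<^sub>\<infinity>y. min (pmf (q1 x) y) (pmf (q2 x) y)) \<le> (\<Sum>\<^sub>\<infinity>y. min (pmf ?p y) (pmf (q1 x) y))"
    by (intro infsum_mono min_pmf_summable_on)
  then show ?thesis
    by (simp add: tv_eq_infsum_min)
qed

text \<open>The weight \<open>pmf p y\<close> cancels the denominator on the support of
  \<open>p\<close>, leaving the \<open>r\<close>-mass of that support. This may be below 1, since
  \<open>r\<close> can charge points outside it.\<close>

lemma nn_integral_pmf_ratio_le_1: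
  "(\<integral>\<^sup>+ y. ennreal (pmf r y / pmf p y) \<partial>measure_pmf p) \<le> 1"
proof -
  have "(\<integral>\<^sup>+ y. ennreal (pmf r y / pmf p y) \<partial>measure_pmf p)
      = (\<integral>\<^sup>+ y. ennreal (pmf p y) * ennreal (pmf r y / pmf p y) \<partial>count_space UNIV)"
    by (rule nn_integral_measure_pmf)
  also have "\<dots> \<le> (\<integral>\<^sup>+ y. ennreal (pmf r y) \<partial>count_space UNIV)"
    \<comment> \<open>Where \<open>pmf p y = 0\<close> the left-hand term is 0, so the value of the
      quotient there is irrelevant.\<close>
    by (intro nn_integral_mono) (simp add: ennreal_mult[symmetric])
  also have "\<dots> = 1"
    by (simp add: nn_integral_pmf)
  finally show ?thesis .
qed

lemma integrable_pmf_ratio: "integrable (measure_pmf p) (\<lambda>y. pmf r y / pmf p y)"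
  using nn_integral_pmf_ratio_le_1[where p = p and r = r]
  by (intro integrableI_nonneg) (auto intro: le_less_trans)

lemma expectation_pmf_ratio_le_1: "measure_pmf.expectation p (\<lambda>y. pmf r y / pmf p y) \<le> 1"
  using nn_integral_pmf_ratio_le_1[where p = p and r = r]
    nn_integral_eq_integral[OF integrable_pmf_ratio[where p = p and r = r]]
  by simp

text \<open>
  With \<open>f = p / q\<close>, the bound is the \<open>p\<close>-expectation of \<open>ln (c f) \<le> c f - 1 = r / p - 1\<close>.
  Integrability of \<open>ln f\<close> follows from \<open>\<bar>ln f\<bar> \<le> f + 1 / f\<close>, as \<open>f = r / (c p)\<close> and
  \<open>1 / f = q / p\<close> both have finite expectation.
\<close>
lemma kl_le_of_ratio:
  fixes p q r :: "'y pmf" and c :: real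
  assumes c: "0 < c" and supp: "set_pmf p \<subseteq> set_pmf q"
    and ratio: "\<And>y. y \<in> set_pmf p \<Longrightarrow> pmf r y / pmf p y = c * (pmf p y / pmf q y)"
  shows "kl p q \<le> ereal (- log 2 c)"
proof -
  let ?f = "\<lambda>y. pmf p y / pmf q y"
  have pos: "0 < ?f y" if "y \<in> set_pmf p" for y
    using that supp by (auto simp: pmf_positive_iff)
  have bnd: "\<bar>ln (?f y)\<bar> \<le> pmf r y / pmf p y / c + pmf q y / pmf p y" if y: "y \<in> set_pmf p" for y
  proof -
    have "- ln (?f y) = ln (inverse (?f y))"
      using pos[OF y] by (subst ln_inverse) auto
    also have "\<dots> \<le> inverse (?f y)"
      by (intro less_imp_le ln_less_self positive_imp_inverse_positive pos y)
    finally have "- ln (?f y) \<le> pmf q y / pmf p y"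
      by simp
    moreover have "ln (?f y) \<le> ?f y"
      by (intro less_imp_le ln_less_self pos y)
    moreover have "pmf r y / pmf p y / c = ?f y"
      using c by (simp add: ratio[OF y])
    moreover have "0 \<le> pmf q y / pmf p y" "0 \<le> ?f y"
      by simp_all
    ultimately show ?thesis
      by linarith
  qed
  have int: "integrable (measure_pmf p) (\<lambda>y. ln (?f y))"
  proof (rule Bochner_Integration.integrable_bound)
    show "integrable (measure_pmf p) (\<lambda>y. pmf r y / pmf p y / c + pmf q y / pmf p y)"
      by (intro Bochner_Integration.integrable_add integrable_divide integrable_pmf_ratio)
    show "AE y in measure_pmf p. norm (ln (?f y))
        \<le> norm (pmf r y / pmf p y / c + pmf q y / pmf p y)"
      using order_trans[OF bnd abs_ge_self] by (simp only: AE_measure_pmf_iff real_norm_def) blast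
  qed simp
  \<comment> \<open>The constant \<open>ln c + 1\<close> integrates to itself; its 1 cancels against
    the bound 1 on the right, which leaves \<open>- ln c\<close>.\<close>
  have "measure_pmf.expectation p (\<lambda>y. ln (?f y) + (ln c + 1))
      \<le> measure_pmf.expectation p (\<lambda>y. pmf r y / pmf p y)"
  proof (rule integral_mono_AE)
    show "AE y in measure_pmf p. ln (?f y) + (ln c + 1) \<le> pmf r y / pmf p y"
    proof (simp only: AE_measure_pmf_iff, intro ballI)
      fix y assume y: "y \<in> set_pmf p"
      have "ln (c * ?f y) \<le> c * ?f y - 1"
        by (intro ln_le_minus_one mult_pos_pos c pos y)
      moreover have "ln (c * ?f y) = ln c + ln (?f y)"
        by (intro ln_mult_pos c pos y)
      ultimately show "ln (?f y) + (ln c + 1) \<le> pmf r y / pmf p y"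
        using ratio[OF y] by linarith
    qed
  qed (use int integrable_pmf_ratio in auto)
  also have "\<dots> \<le> 1"
    by (rule expectation_pmf_ratio_le_1)
  finally have "measure_pmf.expectation p (\<lambda>y. ln (?f y)) \<le> - ln c"
    using int by simp
  then have "measure_pmf.expectation p (\<lambda>y. log 2 (?f y)) \<le> - log 2 c"
    by (simp add: log_def pos_divide_le_eq)
  \<comment> \<open>Integrability and \<open>supp\<close> together select the finite branch of
    \<open>kl\<close>.\<close>
  moreover have "integrable (measure_pmf p) (\<lambda>y. log 2 (?f y))"
    unfolding log_def using int by simp
  ultimately show ?thesis
    using supp by (simp add: kl_def)
qed

text \<open>The defining relation \<open>(p Z)\<^sup>2 = q1 q2\<close> reads \<open>q2 / p = Z\<^sup>2 (p / q1)\<close>.\<close>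
lemma kl_cp_model_le:
  assumes Z: "0 < cp_Z Delta_KL q1 q2 x"
  shows "kl (cp_model Delta_KL q1 q2 x) (q1 x)
    \<le> ereal (- 2 * log 2 (1 - hellinger_sq (q1 x) (q2 x)))"
proof -
  let ?p = "cp_model Delta_KL q1 q2 x" and ?Z = "cp_Z Delta_KL q1 q2 x"
  have p: "pmf ?p y = sqrt (pmf (q1 x) y * pmf (q2 x) y) / ?Z" for y
    using pmf_cp_model[OF Z] by simp
  \<comment> \<open>A zero of \<open>q1\<close> makes the geometric mean vanish, so \<open>p\<close>
    has no mass there.\<close>
  have q1: "pmf (q1 x) y \<noteq> 0" if "y \<in> set_pmf ?p" for y
    using that by (auto simp: set_pmf_iff p)
  have "kl ?p (q1 x) \<le> ereal (- log 2 (?Z\<^sup>2))"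
  proof (rule kl_le_of_ratio[where r = "q2 x"])
    show "0 < ?Z\<^sup>2"
      using Z by simp
    show "set_pmf ?p \<subseteq> set_pmf (q1 x)"
      using q1 by (auto simp: set_pmf_iff)
    fix y assume y: "y \<in> set_pmf ?p"
    have "(pmf ?p y * ?Z)\<^sup>2 = pmf (q1 x) y * pmf (q2 x) y"
      using Z by (simp add: p)
    then show "pmf (q2 x) y / pmf ?p y = ?Z\<^sup>2 * (pmf ?p y / pmf (q1 x) y)"
      using q1[OF y] y by (simp add: set_pmf_iff field_simps power2_eq_square)
  qed
  \<comment> \<open>The factor 2 is the exponent of \<open>?Z\<^sup>2\<close>.\<close>
  then show ?thesis
    using Z by (simp add: log_nat_power cp_Z_KL)
qed

lemma hellinger_sq_commute: "hellinger_sq p q = hellinger_sq q p"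
  by (simp add: hellinger_sq_def mult.commute)

theorem lemma3p4:
  fixes A :: "('z, 'x, 'y::countable) learner"
    and D :: "'z multiset"
    and q1 q2 p :: "('x, 'y) cond_model"
    and \<Delta> :: divergence
  assumes "sharded_safe A D q1 q2"
    and "\<And>x. 0 < cp_Z \<Delta> q1 q2 x"
    and "p = cp_model \<Delta> q1 q2"
  shows "\<forall>x. \<forall>q\<in>{q1, q2}.
           (\<Delta> = Delta_max \<longrightarrow> tv (p x) (q x) \<le> tv (q1 x) (q2 x)) \<and>
           (\<Delta> = Delta_KL \<longrightarrow>
              kl (p x) (q x) \<le> ereal (- 2 * log 2 (1 - hellinger_sq (q1 x) (q2 x))))"
proof (intro allI ballI conjI impI)
  fix x q assume q: "q \<in> {q1, q2}" and "\<Delta> = Delta_max"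
  then have Z: "0 < cp_Z Delta_max q1 q2 x" and p: "p = cp_model Delta_max q1 q2"
    using assms(2,3) by auto
  show "tv (p x) (q x) \<le> tv (q1 x) (q2 x)"
    \<comment> \<open>The case \<open>q = q2\<close> is the bound for the swapped pair, rewritten by
      symmetry.\<close>
    using q tv_cp_model_le[OF Z] tv_cp_model_le[of q2 q1 x] Z
    by (auto simp: p cp_model_commute[of _ q2 q1] cp_Z_commute[of _ q2 q1]
        tv_commute[of "q2 x"])
next
  fix x q assume q: "q \<in> {q1, q2}" and "\<Delta> = Delta_KL"
  then have Z: "0 < cp_Z Delta_KL q1 q2 x" and p: "p = cp_model Delta_KL q1 q2"
    using assms(2,3) by auto
  show "kl (p x) (q x) \<le> ereal (- 2 * log 2 (1 - hellinger_sq (q1 x) (q2 x)))"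
    using q kl_cp_model_le[OF Z] kl_cp_model_le[of q2 q1 x] Z
    by (auto simp: p cp_model_commute[of _ q2 q1] cp_Z_commute[of _ q2 q1]
        hellinger_sq_commute[of "q2 x"])
qed

end
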